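(* Let $X\subseteq\mathbb{R}$ be a set of reals such that $(X[\leq])^2$ is normal. If there exists a strictly decreasing function $f:X\to X$ (not necessarily continuous with respect to the Euclidean topology), then $X\setminus C$ is a $Q$-set for some countable subset $C$ of $X$.
   Context: For $X\subseteq\mathbb{R}$, $X[\leq]$ denotes $X$ with the subspace topology inherited from the Sorgenfrey line, i.e. from $\mathbb{R}$ with the topology generated by the half-open intervals $[a,b)$; $(X[\leq])^2$ is the product space $X[\leq]\times X[\leq]$. A $Q$-set is an uncountable subset of the reals with the property that every subset of it is $G_\delta$ (equivalently, every subset of it is $F_\sigma$) in the relative Euclidean subspace topology.
   Formalization: The set X is additionally assumed to be uncountable; for countable X (e.g. the rationals with f(x) = -x) the claim fails, since a Q-set is uncountable by definition. *)

theory Defs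
  imports "HOL-Analysis.Analysis"
begin

definition sorgenfrey_line :: "real topology" where
  "sorgenfrey_line = topology_generated_by {{a..<b} | a b. a < b}"

definition sorgenfrey_on :: "real set \<Rightarrow> real topology" where
  "sorgenfrey_on X = subtopology sorgenfrey_line X"

definition Q_set :: "real set \<Rightarrow> bool" where
  "Q_set X \<longleftrightarrow> uncountable X \<and> (\<forall>A\<subseteq>X. gdelta_in (top_of_set X) A)"

lemma topspace_sorgenfrey_line [simp]: "topspace sorgenfrey_line = UNIV"
proof -
  have "x \<in> \<Union>{{a..<b} | a b. a < b}" for x :: real
  proof (rule UnionI)
    show "{x..<x + 1} \<in> {{a..<b} | a b. a < b}"
      by (rule CollectI, rule exI[of _ x], rule exI[of _ "x + 1"]) simp
  qed simp
  then show ?thesis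
    unfolding sorgenfrey_line_def topology_generated_by_topspace by blast
qed

lemma topspace_sorgenfrey_on [simp]: "topspace (sorgenfrey_on X) = X"
  by (simp add: sorgenfrey_on_def)

end

theory Submission
  imports Defs
begin

text \<open>The graph of a strictly decreasing \<open>f\<close> over any subset of \<open>X\<close> is closed in the Sorgenfrey
  square, so normality separates the graph over \<open>A\<close> from the graph over \<open>X - A\<close> by open sets.
  (For closedness: moving towards a limit point \<open>(a, b)\<close> of the graph inside its upper right quadrant
  would decrease both \<open>x\<close> and \<open>f x\<close>.)
  Let \<open>W n\<close> be the set of \<open>x \<in> A\<close> such that the half-open square of side \<open>1 / (n + 1)\<close> at
  \<open>(x, f x)\<close> lies in the first open set. If \<open>y \<in> X - A\<close> is a point of Euclidean continuity of \<open>f\<close>,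
  then \<open>y\<close> is not in the closure of \<open>W n\<close>: for \<open>x \<in> W n\<close> close to \<open>y\<close> the corner
  \<open>(max x y, max (f x) (f y))\<close> would lie in both open sets. Hence \<open>A\<close> is \<open>F\<^sub>\<sigma>\<close> off the set of
  discontinuities of \<open>f\<close>, which is countable by monotonicity.\<close>

section \<open>Basic neighbourhoods in the Sorgenfrey line and its square\<close>

lemma openin_sorgenfrey_line_iff:
  "openin sorgenfrey_line U \<longleftrightarrow> (\<forall>x\<in>U. \<exists>e>0. {x..<x + e} \<subseteq> U)"
proof
  assume "openin sorgenfrey_line U"
  then have "generate_topology_on {{a..<b} | a b :: real. a < b} U"
    by (simp add: sorgenfrey_line_def openin_topology_generated_by_iff)
  then show "\<forall>x\<in>U. \<exists>e>0. {x..<x + e} \<subseteq> U"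
  proof induction
    case (Int U V)
    show ?case
    proof
      fix x assume "x \<in> U \<inter> V"
      then obtain d e where "d > 0" "{x..<x + d} \<subseteq> U" "e > 0" "{x..<x + e} \<subseteq> V"
        using Int.IH by blast
      then have "min d e > 0 \<and> {x..<x + min d e} \<subseteq> U \<inter> V"
        by fastforce
      then show "\<exists>e>0. {x..<x + e} \<subseteq> U \<inter> V"
        by blast
    qed
  next
    case (UN K)
    then show ?case
      by (meson Union_iff Union_upper subset_trans)
  next
    case (Basis S)
    then obtain a b :: real where S: "S = {a..<b}"
      by auto
    show ?case
    proof
      fix x assume "x \<in> S"
      then have "b - x > 0 \<and> {x..<x + (b - x)} \<subseteq> S"
        by (auto simp: S)
      then show "\<exists>e>0. {x..<x + e} \<subseteq> S"
        by blast
    qed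
  qed auto
next
  assume *: "\<forall>x\<in>U. \<exists>e>0. {x..<x + e} \<subseteq> U"
  show "openin sorgenfrey_line U"
  proof (subst openin_subopen, intro ballI)
    fix x assume "x \<in> U"
    with * obtain e where "e > 0" "{x..<x + e} \<subseteq> U"
      by blast
    moreover have "openin sorgenfrey_line {x..<x + e}"
      unfolding sorgenfrey_line_def
      by (intro topology_generated_by_Basis CollectI exI[of _ x] exI[of _ "x + e"])
        (use \<open>e > 0\<close> in simp)
    ultimately show "\<exists>T. openin sorgenfrey_line T \<and> x \<in> T \<and> T \<subseteq> U"
      using \<open>e > 0\<close> by (intro exI[of _ "{x..<x + e}"]) auto
  qed
qed

lemma openin_sorgenfrey_on_interval: "openin (sorgenfrey_on X) (X \<inter> {a..<b})"
proof -
  have "openin sorgenfrey_line {a..<b}"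
    unfolding openin_sorgenfrey_line_iff
  proof
    fix x assume "x \<in> {a..<b}"
    then show "\<exists>e>0. {x..<x + e} \<subseteq> {a..<b}"
      by (intro exI[of _ "b - x"]) auto
  qed
  then show ?thesis
    unfolding sorgenfrey_on_def openin_subtopology by blast
qed

lemma openin_sorgenfrey_onD:
  assumes "openin (sorgenfrey_on X) U" "x \<in> U"
  shows "\<exists>e>0. X \<inter> {x..<x + e} \<subseteq> U"
proof -
  obtain T where "openin sorgenfrey_line T" "U = T \<inter> X"
    using assms(1) by (auto simp: sorgenfrey_on_def openin_subtopology)
  then show ?thesis
    using assms(2) unfolding openin_sorgenfrey_line_iff by blast
qed

text \<open>The smaller of two side lengths shrinks a basic rectangle to a square, so one number
  measures the room a point has in \<open>U\<close>. The later sets \<open>W n\<close> are graded by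
  this number.\<close>

lemma openin_sorgenfrey_square_iff:
  "openin (prod_topology (sorgenfrey_on X) (sorgenfrey_on X)) U \<longleftrightarrow>
     U \<subseteq> X \<times> X \<and>
     (\<forall>x y. (x, y) \<in> U \<longrightarrow> (\<exists>e>0. (X \<inter> {x..<x + e}) \<times> (X \<inter> {y..<y + e}) \<subseteq> U))"
    (is "?lhs \<longleftrightarrow> ?rhs")
proof
  assume U: ?lhs
  show ?rhs
  proof (intro conjI allI impI)
    show "U \<subseteq> X \<times> X"
      using openin_subset[OF U] by simp
    fix x y assume "(x, y) \<in> U"
    then obtain V W where V: "openin (sorgenfrey_on X) V" "x \<in> V"
      and W: "openin (sorgenfrey_on X) W" "y \<in> W" and VW: "V \<times> W \<subseteq> U"
      using U unfolding openin_prod_topology_alt by meson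
    obtain d e where "d > 0" "X \<inter> {x..<x + d} \<subseteq> V" "e > 0" "X \<inter> {y..<y + e} \<subseteq> W"
      using openin_sorgenfrey_onD[OF V] openin_sorgenfrey_onD[OF W] by blast
    then have "(X \<inter> {x..<x + min d e}) \<times> (X \<inter> {y..<y + min d e}) \<subseteq> V \<times> W" "min d e > 0"
      by fastforce+
    with VW show "\<exists>e>0. (X \<inter> {x..<x + e}) \<times> (X \<inter> {y..<y + e}) \<subseteq> U"
      by (meson subset_trans)
  qed
next
  assume U: ?rhs
  show ?lhs
    unfolding openin_prod_topology_alt
  proof (intro allI impI)
    fix x y assume xy: "(x, y) \<in> U"
    then obtain e where "e > 0" "(X \<inter> {x..<x + e}) \<times> (X \<inter> {y..<y + e}) \<subseteq> U"
      using U by blast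
    then show "\<exists>V W. openin (sorgenfrey_on X) V \<and> openin (sorgenfrey_on X) W \<and>
        x \<in> V \<and> y \<in> W \<and> V \<times> W \<subseteq> U"
      using U xy
      by (intro exI[of _ "X \<inter> {x..<x + e}"] exI[of _ "X \<inter> {y..<y + e}"])
        (auto simp: openin_sorgenfrey_on_interval)
  qed
qed

section \<open>Closedness of decreasing graphs\<close>

lemma closedin_sorgenfrey_square_graph:
  fixes f :: "real \<Rightarrow> real"
  assumes f: "f ` X \<subseteq> X" "strict_antimono_on X f" and A: "A \<subseteq> X"
  shows "closedin (prod_topology (sorgenfrey_on X) (sorgenfrey_on X)) ((\<lambda>x. (x, f x)) ` A)"
    (is "closedin _ ?G")
proof -
  have less: "f y < f x" if "x \<in> A" "y \<in> A" "x < y" for x y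
    using f(2) A that by (auto simp: monotone_on_def)
  have "\<exists>e>0. (X \<inter> {a..<a + e}) \<times> (X \<inter> {b..<b + e}) \<subseteq> X \<times> X - ?G"
    if ab: "(a, b) \<notin> ?G" for a b
  proof (rule ccontr)
    assume "\<not> ?thesis"
    then have ex: "\<exists>x\<in>A. a \<le> x \<and> x < a + e \<and> b \<le> f x \<and> f x < b + e" if "e > 0" for e
      using that by fastforce
    \<comment> \<open>With \<open>e\<close> equal to the smaller offset, the new graph point lies
      strictly below and to the left of \<open>(x, f x)\<close>, which a strictly decreasing
      \<open>f\<close> forbids. So graph points in the closed quadrant at \<open>(a, b)\<close> lie
      on its edges.\<close>
    have no_strict: False if x: "x \<in> A" "a < x" "b < f x" for x
    proof -
      obtain y where "y \<in> A" "y < x" "f y < f x"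
        using ex[of "min (x - a) (f x - b)"] x by force
      then show False
        using less[of y x] x by auto
    qed
    have ne: "x \<noteq> a \<or> f x \<noteq> b" if "x \<in> A" for x
      using ab that by auto
    \<comment> \<open>A graph point on the left edge is \<open>(a, f a)\<close>. A square lower than
      \<open>f a\<close> gives a point \<open>x > a\<close> on the bottom edge; one also narrower
      than \<open>x - a\<close> gives \<open>y\<close> with \<open>a < y < x\<close>. Then
      \<open>f y > f x = b\<close>, so \<open>no_strict\<close> applies.\<close>
    have no_left: False if a: "a \<in> A" "b < f a"
    proof -
      obtain x where x: "x \<in> A" "a \<le> x" "b \<le> f x" "f x < f a"
        using ex[of "f a - b"] a by auto
      then have "a < x"
        by (cases "x = a") auto
      then have "f x = b"
        using no_strict[of x] x by force
      then obtain y where "y \<in> A" "a \<le> y" "y < x" "f y < f a"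
        using ex[of "min (x - a) (f a - b)"] a \<open>a < x\<close> \<open>f x = b\<close> by force
      then show False
        using no_strict[of y] less[of y x] x \<open>f x = b\<close> by (cases "y = a") auto
    qed
    obtain x where x: "x \<in> A" "a \<le> x" "b \<le> f x"
      using ex[of 1] by auto
    \<comment> \<open>Only the bottom edge remains. A graph point over some \<open>y < x\<close> has
      \<open>f y > f x = b\<close>, so it falls under one of the two excluded cases.\<close>
    have "x \<noteq> a"
      using no_left ne[OF x(1)] x by (cases "f x = b") auto
    then have "a < x"
      using x by simp
    then have "f x = b"
      using no_strict[of x] x by force
    then obtain y where "y \<in> A" "a \<le> y" "y < x"
      using ex[of "x - a"] \<open>a < x\<close> by auto
    then show False
      using no_strict[of y] no_left less[of y x] x \<open>f x = b\<close> by (cases "y = a") auto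
  qed
  then have "openin (prod_topology (sorgenfrey_on X) (sorgenfrey_on X)) (X \<times> X - ?G)"
    unfolding openin_sorgenfrey_square_iff by blast
  moreover have "?G \<subseteq> X \<times> X"
    using f(1) A by auto
  ultimately show ?thesis
    by (simp add: closedin_def)
qed

text \<open>Since \<open>d\<close> serves all of \<open>W\<close>, the point \<open>x\<close> of
  \<open>W\<close> can be chosen close to \<open>y\<close> on a scale fixed by \<open>d\<close> and
  \<open>e\<close>. Continuity brings \<open>f x\<close> equally close to \<open>f y\<close>, and
  the two squares then meet.\<close>

lemma closure_disjoint_from_opposite_square:
  fixes f :: "real \<Rightarrow> real"
  assumes f: "f ` X \<subseteq> X" and "W \<subseteq> X" "y \<in> X"
    and cont: "continuous (at y within X) f"
    and "d > 0" and W: "\<And>x. x \<in> W \<Longrightarrow> (X \<inter> {x..<x + d}) \<times> (X \<inter> {f x..<f x + d}) \<subseteq> U"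
    and "e > 0" and y: "(X \<inter> {y..<y + e}) \<times> (X \<inter> {f y..<f y + e}) \<subseteq> V"
    and "disjnt U V"
  shows "y \<notin> closure W"
proof
  assume "y \<in> closure W"
  define r where "r = min d e"
  have "r > 0"
    using \<open>d > 0\<close> \<open>e > 0\<close> by (simp add: r_def)
  then obtain s where "s > 0" and s: "\<And>x. x \<in> X \<Longrightarrow> dist x y < s \<Longrightarrow> dist (f x) (f y) < r"
    using cont unfolding continuous_within_eps_delta by meson
  obtain x where "x \<in> W" and xy: "dist x y < min r s"
    using \<open>y \<in> closure W\<close> \<open>r > 0\<close> \<open>s > 0\<close> by (meson closure_approachable min_less_iff_conj)
  have "x \<in> X"
    using \<open>x \<in> W\<close> \<open>W \<subseteq> X\<close> by blast
  have fxy: "dist (f x) (f y) < r"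
    using s \<open>x \<in> X\<close> xy by auto
  \<comment> \<open>Each coordinate is one of two members of \<open>X\<close>, so the corner stays
    in \<open>X \<times> X\<close>. All its offsets are below \<open>r\<close>, which puts it in
    both squares.\<close>
  let ?p = "(max x y, max (f x) (f y))"
  have "?p \<in> X \<times> X"
    using \<open>x \<in> X\<close> \<open>y \<in> X\<close> f by (auto simp: max_def)
  moreover have "max x y \<in> {x..<x + d} \<inter> {y..<y + e}"
    using xy \<open>r > 0\<close> by (auto simp: r_def dist_real_def)
  moreover have "max (f x) (f y) \<in> {f x..<f x + d} \<inter> {f y..<f y + e}"
    using fxy \<open>r > 0\<close> by (auto simp: r_def dist_real_def)
  ultimately have "?p \<in> U" "?p \<in> V"
    using W[OF \<open>x \<in> W\<close>] y by blast+
  then show False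
    using \<open>disjnt U V\<close> by (auto simp: disjnt_iff)
qed

text \<open>\<open>- f\<close> is monotone, and continuity of \<open>- f\<close> at a point gives
  that of \<open>f\<close>, so the countability theorem for monotone functions applies.\<close>

lemma countable_discontinuities_strict_antimono_on:
  fixes f :: "real \<Rightarrow> real"
  assumes "strict_antimono_on X f"
  shows "countable {x \<in> X. \<not> continuous (at x within X) f}"
proof -
  have "mono_on X (\<lambda>x. - f x)"
    using assms by (auto simp: monotone_on_def order_le_less)
  then have "countable {x \<in> X. \<not> continuous (at x within X) (\<lambda>x. - f x)}"
    by (rule mono_on_ctble_discont)
  moreover have "continuous (at x within X) f" if "continuous (at x within X) (\<lambda>x. - f x)" for x
    using continuous_minus[OF that] by simp
  ultimately show ?thesis
    by (auto elim!: countable_subset[rotated])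
qed

section \<open>From normality to Euclidean F-sigma sets\<close>

lemma fsigma_in_continuity_points:
  fixes f :: "real \<Rightarrow> real"
  assumes normal: "normal_space (prod_topology (sorgenfrey_on X) (sorgenfrey_on X))"
    and f: "f ` X \<subseteq> X" "strict_antimono_on X f"
    and Y: "Y \<subseteq> X" "\<And>y. y \<in> Y \<Longrightarrow> continuous (at y within X) f" and "A \<subseteq> Y"
  shows "fsigma_in (top_of_set Y) A"
proof -
  let ?T = "prod_topology (sorgenfrey_on X) (sorgenfrey_on X)"
  let ?G = "\<lambda>S. (\<lambda>x. (x, f x)) ` S"
  have "A \<subseteq> X"
    using \<open>A \<subseteq> Y\<close> Y(1) by blast
  have "disjnt (?G A) (?G (X - A))"
    by (auto simp: disjnt_iff)
  moreover have "closedin ?T (?G A)" "closedin ?T (?G (X - A))"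
    using closedin_sorgenfrey_square_graph[OF f] \<open>A \<subseteq> X\<close> by auto
  ultimately obtain U V where U: "openin ?T U" "?G A \<subseteq> U" and V: "openin ?T V" "?G (X - A) \<subseteq> V"
    and "disjnt U V"
    using normal unfolding normal_space_def by meson
  \<comment> \<open>The sides \<open>inverse (Suc n)\<close> grade \<open>A\<close> into countably
    many sets, each with the uniform side that the closure lemma requires.\<close>
  define W where "W n = {x \<in> A. (X \<inter> {x..<x + inverse (Suc n)}) \<times>
    (X \<inter> {f x..<f x + inverse (Suc n)}) \<subseteq> U}" for n
  have "y \<in> A" if "y \<in> Y" "y \<in> closure (W n)" for y n
  proof (rule ccontr)
    assume "y \<notin> A"
    then have "(y, f y) \<in> V"
      using V(2) \<open>y \<in> Y\<close> Y(1) by blast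
    then obtain e where "e > 0" "(X \<inter> {y..<y + e}) \<times> (X \<inter> {f y..<f y + e}) \<subseteq> V"
      using V(1) unfolding openin_sorgenfrey_square_iff by meson
    then have "y \<notin> closure (W n)"
      using that(1) Y \<open>A \<subseteq> X\<close> \<open>disjnt U V\<close>
      by (intro closure_disjoint_from_opposite_square[OF f(1), of _ _ "inverse (Suc n)" U e V])
        (auto simp: W_def)
    with that(2) show False
      by blast
  qed
  moreover have "\<exists>n. x \<in> W n" if "x \<in> A" for x
  proof -
    have "(x, f x) \<in> U"
      using U(2) that by blast
    then obtain e where "e > 0" and e: "(X \<inter> {x..<x + e}) \<times> (X \<inter> {f x..<f x + e}) \<subseteq> U"
      using U(1) unfolding openin_sorgenfrey_square_iff by meson
    obtain n where "inverse (Suc n) < e"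
      using reals_Archimedean[OF \<open>e > 0\<close>] by auto
    then have "X \<inter> {z..<z + inverse (Suc n)} \<subseteq> X \<inter> {z..<z + e}" for z
      by auto
    then have "x \<in> W n"
      unfolding W_def using that e by (blast intro: order_trans Sigma_mono)
    then show ?thesis ..
  qed
  moreover have "W n \<subseteq> closure (W n)" for n
    by (rule closure_subset)
  \<comment> \<open>The Euclidean closures of the \<open>W n\<close> miss \<open>Y - A\<close> and
    together cover \<open>A\<close>, so their traces on \<open>Y\<close> are relatively closed sets
    with union \<open>A\<close>.\<close>
  ultimately have "A = (\<Union>n. Y \<inter> closure (W n))"
    using \<open>A \<subseteq> Y\<close> by fast
  moreover have "fsigma_in (top_of_set Y) (\<Union>n. Y \<inter> closure (W n))"
    by (intro fsigma_in_Union)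
      (auto intro!: closed_imp_fsigma_in closedin_closed_Int)
  ultimately show ?thesis
    by simp
qed

theorem proposition2p5:
  fixes X :: "real set"
  assumes "uncountable X"
    and "normal_space (prod_topology (sorgenfrey_on X) (sorgenfrey_on X))"
    and "\<exists>f. f ` X \<subseteq> X \<and> strict_antimono_on X f"
  shows "\<exists>C. C \<subseteq> X \<and> countable C \<and> Q_set (X - C)"
proof -
  obtain f where f: "f ` X \<subseteq> X" "strict_antimono_on X f"
    using assms(3) by blast
  define C where "C = {x \<in> X. \<not> continuous (at x within X) f}"
  have "countable C"
    unfolding C_def using f(2) by (rule countable_discontinuities_strict_antimono_on)
  moreover have "C \<subseteq> X"
    by (auto simp: C_def)
  moreover have "uncountable (X - C)"
    using assms(1) \<open>countable C\<close> by (simp add: uncountable_minus_countable)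
  moreover have "gdelta_in (top_of_set (X - C)) A" if "A \<subseteq> X - C" for A
  proof -
    \<comment> \<open>The F-sigma result is applied to the relative complement, which makes
      \<open>A\<close> itself G-delta.\<close>
    have "fsigma_in (top_of_set (X - C)) (X - C - A)"
      by (rule fsigma_in_continuity_points[OF assms(2) f]) (auto simp: C_def)
    with that show ?thesis
      by (simp add: gdelta_in_fsigma_in)
  qed
  ultimately show ?thesis
    unfolding Q_set_def by (intro exI[of _ C]) simp
qed

end
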